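(* Let $p\in[0,1/2)$ be a fixed constant (independent of $n$). Then, asymptotically almost surely (i.e., with probability tending to $1$ as $n\to\infty$), the random graph $G\sim G(n,p)$ has the property that every orientation of $G$ contains a Seymour vertex.
   Context: $G(n,p)$ denotes the binomial random graph on $n$ vertices in which each of the $\binom{n}{2}$ possible edges is present independently with probability $p$. An orientation of a (finite, simple) graph assigns a direction to each edge, giving an oriented graph. For a digraph $D$ and $v\in V(D)$, the outneighbourhood is $N_1(v)=\{w\in V(D)\setminus\{v\}: vw\in E(D)\}$, and the second outneighbourhood is $N_2(v)=\{w\in V(D)\setminus(\{v\}\cup N_1(v)): \text{there is an edge from some vertex of } N_1(v) \text{ to } w\}$. A vertex $v$ is a Seymour vertex if $|N_2(v)|\ge |N_1(v)|$. *)

theory Defs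
  imports "HOL-Probability.Probability"
begin

text \<open>Undirected edges are two-element sets of vertices; directed edges are ordered pairs.\<close>

definition complete_edges :: "'a set \<Rightarrow> 'a set set" where
  "complete_edges V = {e. e \<subseteq> V \<and> card e = 2}"

text \<open>The binomial random graph on the vertex set \<open>{..<n}\<close>, as a distribution on edge sets.
  The value \<open>False\<close> is only the default of the product outside the potential edges.\<close>

definition gnp :: "nat \<Rightarrow> real \<Rightarrow> nat set set pmf" where
  "gnp n p = map_pmf (\<lambda>f. {e \<in> complete_edges {..<n}. f e})
     (Pi_pmf (complete_edges {..<n}) False (\<lambda>_. bernoulli_pmf p))"

definition orientation_of :: "'a set set \<Rightarrow> ('a \<times> 'a) set \<Rightarrow> bool" where
  "orientation_of E A \<longleftrightarrow>
     (\<forall>u v. (u, v) \<in> A \<longrightarrow> {u, v} \<in> E) \<and>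
     (\<forall>u v. {u, v} \<in> E \<longrightarrow> ((u, v) \<in> A \<longleftrightarrow> (v, u) \<notin> A))"

definition out_nbhd :: "'a set \<Rightarrow> ('a \<times> 'a) set \<Rightarrow> 'a \<Rightarrow> 'a set" where
  "out_nbhd V A v = {w \<in> V - {v}. (v, w) \<in> A}"

definition second_out_nbhd :: "'a set \<Rightarrow> ('a \<times> 'a) set \<Rightarrow> 'a \<Rightarrow> 'a set" where
  "second_out_nbhd V A v =
     {w \<in> V - ({v} \<union> out_nbhd V A v). \<exists>u \<in> out_nbhd V A v. (u, w) \<in> A}"

definition seymour_vertex :: "'a set \<Rightarrow> ('a \<times> 'a) set \<Rightarrow> 'a \<Rightarrow> bool" where
  "seymour_vertex V A v \<longleftrightarrow>
     v \<in> V \<and> card (second_out_nbhd V A v) \<ge> card (out_nbhd V A v)"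

end

theory Submission
  imports Defs "HOL-Real_Asymp.Real_Asymp"
begin

text \<open>
  Asymptotically almost surely, any two disjoint linear-sized vertex sets span at least half the
  expected number of edges, and all degrees are at most \<open>(1/2 - \<gamma>) n\<close> for some \<open>\<gamma> > 0\<close>. If an
  orientation of such a graph has no Seymour vertex, then the first two outneighbourhoods of any
  vertex miss a set \<open>Z\<close> of at least \<open>2 \<gamma> n\<close> vertices. A suitable vertex of \<open>Z\<close> robustly reaches,
  within two steps, almost everything that the original vertex did, and in addition linearly many
  vertices of \<open>Z\<close>. Repeating this boundedly many times reaches more than \<open>n\<close> vertices.
\<close>

section \<open>Neighbourhoods and edge density\<close>

lemma card_frequently_related_le:
  fixes a m :: real
  assumes "finite I" "finite J" and "\<And>j. j \<in> J \<Longrightarrow> card {i \<in> I. R i j} \<le> m"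
  shows "a * card {i \<in> I. a \<le> card {j \<in> J. R i j}} \<le> m * card J"
proof -
  have "a * card {i \<in> I. a \<le> card {j \<in> J. R i j}}
      \<le> (\<Sum>i | i \<in> I \<and> a \<le> card {j \<in> J. R i j}. real (card {j \<in> J. R i j}))"
    by (subst mult.commute, rule sum_bounded_below) auto
  also have "\<dots> \<le> (\<Sum>i\<in>I. real (card {j \<in> J. R i j}))"
    using assms by (intro sum_mono2) auto
  also have "\<dots> = real (\<Sum>j\<in>J. card {i \<in> I. R i j})"
    using sum_multicount_gen[OF assms(1,2), of R "\<lambda>j. card {i \<in> I. R i j}"]
    by (simp flip: of_nat_sum)
  also have "\<dots> \<le> m * card J"
    using sum_bounded_above[of J "\<lambda>j. real (card {i \<in> I. R i j})" m] assms(3)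
    by (simp add: mult.commute)
  finally show ?thesis .
qed

definition nbhd :: "'a set \<Rightarrow> 'a set set \<Rightarrow> 'a \<Rightarrow> 'a set" where
  "nbhd V E v = {w \<in> V - {v}. {v, w} \<in> E}"

definition edges_between :: "'a set set \<Rightarrow> 'a set \<Rightarrow> 'a set \<Rightarrow> ('a \<times> 'a) set" where
  "edges_between E S T = {(s, t) \<in> S \<times> T. {s, t} \<in> E}"

definition bidense :: "'a set \<Rightarrow> 'a set set \<Rightarrow> real \<Rightarrow> real \<Rightarrow> bool" where
  "bidense V E q m \<longleftrightarrow>
     (\<forall>S T. S \<subseteq> V \<longrightarrow> T \<subseteq> V \<longrightarrow> S \<inter> T = {} \<longrightarrow> m \<le> card S \<longrightarrow> m \<le> card T \<longrightarrow>
       q * (card S * card T) \<le> card (edges_between E S T))"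

lemma finite_nbhd [simp]: "finite V \<Longrightarrow> finite (nbhd V E v)"
  by (simp add: nbhd_def)

lemma finite_out_nbhd [simp]: "finite V \<Longrightarrow> finite (out_nbhd V A v)"
  by (simp add: out_nbhd_def)

lemma out_nbhd_subset_nbhd: "orientation_of E A \<Longrightarrow> out_nbhd V A v \<subseteq> nbhd V E v"
  by (auto simp: out_nbhd_def nbhd_def orientation_of_def)

lemma out_nbhd_mono: "U \<subseteq> V \<Longrightarrow> out_nbhd U A v \<subseteq> out_nbhd V A v"
  by (auto simp: out_nbhd_def)

lemma card_edges_between_eq_sum_nbhd:
  assumes "finite S" "finite T" "S \<inter> T = {}"
  shows "card (edges_between E S T) = (\<Sum>s\<in>S. card (nbhd T E s))"
proof -
  have "edges_between E S T = (SIGMA s:S. nbhd T E s)"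
    using assms by (auto simp: edges_between_def nbhd_def)
  then show ?thesis
    using assms by simp
qed

lemma card_edges_between_le_sum_out_nbhd:
  assumes "orientation_of E A" "finite U" "S \<subseteq> U" "T \<subseteq> U" "S \<inter> T = {}"
  shows "card (edges_between E S T) \<le> (\<Sum>u\<in>U. card (out_nbhd U A u))"
proof -
  define orient where "orient = (\<lambda>(s, t). if (s, t) \<in> A then (s, t) else (t, s))"
  have "inj_on orient (edges_between E S T)"
    using assms(5) by (auto simp: inj_on_def orient_def edges_between_def split: if_splits)
  moreover have "orient ` edges_between E S T \<subseteq> (SIGMA u:U. out_nbhd U A u)"
  proof (rule image_subsetI)
    fix e assume "e \<in> edges_between E S T"
    then obtain s t where e: "e = (s, t)" and "s \<in> U" "t \<in> U" "s \<noteq> t" "{s, t} \<in> E"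
      using assms unfolding edges_between_def by blast
    moreover from this have "(s, t) \<in> A \<or> (t, s) \<in> A"
      using assms(1) by (auto simp: orientation_of_def)
    ultimately show "orient e \<in> (SIGMA u:U. out_nbhd U A u)"
      by (auto simp: e orient_def out_nbhd_def)
  qed
  ultimately have "card (edges_between E S T) \<le> card (SIGMA u:U. out_nbhd U A u)"
    using assms by (intro card_inj_on_le[of orient]) auto
  then show ?thesis
    using assms by simp
qed

lemma seymour_vertex_if_no_edges:
  assumes "orientation_of {} A" "v \<in> V"
  shows "seymour_vertex V A v"
  using assms by (simp add: seymour_vertex_def out_nbhd_def orientation_of_def)

section \<open>Robust reachability\<close>

locale oriented_graph =
  fixes V :: "'a set" and E :: "'a set set" and A :: "('a \<times> 'a) set"
  assumes finite_V: "finite V" and orientation: "orientation_of E A"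
begin

definition midpoints :: "'a \<Rightarrow> 'a \<Rightarrow> 'a set" where
  "midpoints v w = {x \<in> out_nbhd V A v. (x, w) \<in> A}"

definition robust_second_out_nbhd :: "real \<Rightarrow> 'a \<Rightarrow> 'a set" where
  "robust_second_out_nbhd t v = {w \<in> V. t \<le> card (midpoints v w)}"

definition reach :: "real \<Rightarrow> 'a \<Rightarrow> 'a set" where
  "reach t v = out_nbhd V A v \<union> robust_second_out_nbhd t v"

definition unreached :: "'a \<Rightarrow> 'a set" where
  "unreached v = V - ({v} \<union> out_nbhd V A v \<union> second_out_nbhd V A v)"

lemma finite_midpoints: "finite (midpoints v w)"
  using finite_V by (simp add: midpoints_def)

lemma reach_subset: "reach t v \<subseteq> V"
  by (auto simp: reach_def robust_second_out_nbhd_def out_nbhd_def)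

lemma finite_reach: "finite (reach t v)"
  using reach_subset finite_V by (rule finite_subset)

lemma unreached_subset: "unreached v \<subseteq> V"
  by (auto simp: unreached_def)

lemma finite_unreached: "finite (unreached v)"
  using unreached_subset finite_V by (rule finite_subset)

lemma midpoints_disjoint_unreached: "midpoints v w \<inter> unreached v = {}"
  by (auto simp: midpoints_def unreached_def)

lemma reach_disjoint_unreached:
  assumes "0 < t"
  shows "reach t v \<inter> unreached v = {}"
proof -
  have "w \<notin> unreached v" if "w \<in> robust_second_out_nbhd t v" for w
  proof -
    have "midpoints v w \<noteq> {}"
      using that assms by (auto simp: robust_second_out_nbhd_def)
    then show ?thesis
      by (auto simp: midpoints_def unreached_def second_out_nbhd_def)
  qed
  then show ?thesis
    by (auto simp: reach_def unreached_def)
qed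

lemma card_le_unreached:
  assumes "v \<in> V" "\<not> seymour_vertex V A v"
  shows "card V \<le> 2 * card (out_nbhd V A v) + card (unreached v)"
proof -
  let ?R = "{v} \<union> out_nbhd V A v \<union> second_out_nbhd V A v"
  have "card ?R \<le> 1 + card (out_nbhd V A v) + card (second_out_nbhd V A v)"
    using card_Un_le[of "{v} \<union> out_nbhd V A v" "second_out_nbhd V A v"]
      card_Un_le[of "{v}" "out_nbhd V A v"] by simp
  also have "\<dots> \<le> 2 * card (out_nbhd V A v)"
    using assms by (simp add: seymour_vertex_def)
  finally have "card ?R \<le> 2 * card (out_nbhd V A v)" .
  moreover have "card V - card ?R \<le> card (unreached v)"
    unfolding unreached_def using finite_V
    by (intro diff_card_le_card_Diff) (simp add: second_out_nbhd_def)
  ultimately show ?thesis by simp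
qed

lemma card_reach_add_card_out_nbhd_unreached_le:
  assumes "0 < t"
  shows "card (reach t v) + card (out_nbhd (unreached v) A z)
    \<le> card (reach t' z) + card (reach t v - reach t' z)"
proof -
  let ?W = "out_nbhd (unreached v) A z"
  have W: "?W \<subseteq> unreached v" "?W \<subseteq> reach t' z"
    using unreached_subset[of v] by (auto simp: out_nbhd_def reach_def)
  then have "card (reach t v \<inter> reach t' z) + card ?W = card (reach t v \<inter> reach t' z \<union> ?W)"
    using reach_disjoint_unreached[OF assms, of v] finite_reach finite_unreached
    by (intro card_Un_disjoint[symmetric]) auto
  also have "\<dots> \<le> card (reach t' z)"
    using W finite_reach by (intro card_mono) auto
  moreover have "card (reach t v) = card (reach t v \<inter> reach t' z) + card (reach t v - reach t' z)"
    using card_Int_Diff finite_reach by blast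
  ultimately show ?thesis by simp
qed

lemma arc_from_unreached:
  assumes "z \<in> unreached v" "x \<in> out_nbhd V A v" "{z, x} \<in> E"
  shows "(z, x) \<in> A"
proof -
  have "(x, z) \<notin> A"
    using assms by (auto simp: unreached_def second_out_nbhd_def)
  then show ?thesis
    using assms orientation by (auto simp: orientation_of_def)
qed

lemma nbhd_midpoints_subset:
  assumes "z \<in> unreached v"
  shows "nbhd (midpoints v w) E z \<subseteq> midpoints z w"
  using arc_from_unreached[OF assms] by (auto simp: nbhd_def midpoints_def out_nbhd_def)

lemma nbhd_out_nbhd_unreached_subset:
  assumes "x \<in> out_nbhd V A v"
  shows "nbhd (out_nbhd (unreached v) A z) E x \<subseteq> midpoints z x"
  using arc_from_unreached[OF _ assms] unreached_subset[of v]
  by (auto simp: nbhd_def midpoints_def out_nbhd_def insert_commute)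

end

locale bidense_graph =
  fixes V :: "'a set" and E :: "'a set set" and q m :: real
  assumes finite_V: "finite V"
    and q_pos: "0 < q" and q_le_1: "q \<le> 1" and m_ge_1: "1 \<le> m"
    and bidense: "bidense V E q m"
begin

definition sparsely_joined :: "'a set \<Rightarrow> 'a \<Rightarrow> bool" where
  "sparsely_joined S u \<longleftrightarrow> card (nbhd S E u) < q * card S"

lemma card_sparsely_joined_less:
  assumes "S \<subseteq> V" "U \<subseteq> V" "S \<inter> U = {}" "m \<le> card S"
  shows "card {u \<in> U. sparsely_joined S u} < m"
proof (rule ccontr)
  define B where "B = {u \<in> U. sparsely_joined S u}"
  assume "\<not> ?thesis"
  then have m_le: "m \<le> card B" by (simp add: B_def)
  have sub: "B \<subseteq> V" and disj: "B \<inter> S = {}"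
    using assms by (auto simp: B_def)
  have fin: "finite B" "finite S"
    using sub assms finite_V finite_subset by blast+
  have "q * (card B * card S) \<le> card (edges_between E B S)"
    using bidense sub assms disj m_le by (simp add: bidense_def)
  also have "\<dots> = (\<Sum>u\<in>B. real (card (nbhd S E u)))"
    using fin disj by (simp add: card_edges_between_eq_sum_nbhd)
  also have "\<dots> < card B * (q * card S)"
    using m_le m_ge_1 by (intro sum_bounded_above_strict) (auto simp: B_def sparsely_joined_def)
  finally show False by (simp add: mult_ac)
qed

end

locale bidense_orientation = oriented_graph V E A + bidense_graph V E q m
  for V :: "'a set" and E A q m
begin

text \<open>The edges between two halves of \<open>U\<close>, some \<open>q (|U|/2)\<^sup>2\<close> at least, are all arcs inside \<open>U\<close>;
  the constant \<open>1/8\<close> leaves room for rounding.\<close>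

lemma ex_large_out_nbhd:
  assumes "U \<subseteq> V" "4 * m \<le> card U"
  obtains u where "u \<in> U" "q * card U / 8 \<le> card (out_nbhd U A u)"
proof (rule ccontr)
  assume none: "\<not> thesis"
  have fin: "finite U" using assms(1) finite_V by (rule finite_subset)
  have four_le: "4 \<le> card U" using assms(2) m_ge_1 by linarith
  obtain S where S: "S \<subseteq> U" "card S = card U div 2"
    by (meson div_le_dividend obtain_subset_with_card_n)
  have card_diff: "card (U - S) = card U - card U div 2"
    using S fin by (simp add: card_Diff_subset finite_subset)
  have quarter: "real (card U) / 4 \<le> card S" and half: "real (card U) / 2 \<le> card (U - S)"
    using S card_diff four_le by linarith+
  have "q * (card U * card U / 8) = q * (real (card U) / 4 * (real (card U) / 2))" by simp
  also have "\<dots> \<le> q * (card S * card (U - S))"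
    using quarter half q_pos unfolding of_nat_mult by (intro mult_left_mono mult_mono) auto
  also have "\<dots> \<le> card (edges_between E S (U - S))"
  proof -
    have "S \<subseteq> V" "U - S \<subseteq> V" "m \<le> card S" "m \<le> card (U - S)"
      using S quarter half assms by auto
    then show ?thesis using bidense by (simp add: bidense_def)
  qed
  also have "\<dots> \<le> (\<Sum>u\<in>U. real (card (out_nbhd U A u)))"
    using card_edges_between_le_sum_out_nbhd[OF orientation fin S(1), of "U - S"]
    by (simp flip: of_nat_sum)
  also have "\<dots> < card U * (q * card U / 8)"
    using none that four_le by (intro sum_bounded_above_strict) (auto simp: not_le[symmetric])
  finally show False by (simp add: mult_ac)
qed

text \<open>All edges between \<open>z\<close> or one of its unreached outneighbours and an outneighbour \<open>x\<close> of \<open>v\<close>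
  point towards \<open>x\<close>. So \<open>z\<close> inherits a share \<open>q\<close> of the paths from \<open>v\<close> to a robust second
  outneighbour, and gets to \<open>x\<close> itself through its unreached outneighbours.\<close>

lemma reach_diff_subset:
  fixes t t' :: real
  assumes z: "z \<in> unreached v"
    and t': "t' \<le> q * t" "t' \<le> q * card (out_nbhd (unreached v) A z)"
  shows "reach t v - reach t' z \<subseteq>
    {x \<in> out_nbhd V A v. sparsely_joined (out_nbhd (unreached v) A z) x} \<union>
    {y \<in> robust_second_out_nbhd t v. sparsely_joined (midpoints v y) z}"
proof -
  let ?W = "out_nbhd (unreached v) A z"
  have "x \<in> reach t' z" if "x \<in> out_nbhd V A v" "\<not> sparsely_joined ?W x" for x
  proof -
    have "t' \<le> card (nbhd ?W E x)"
      using t' that by (simp add: sparsely_joined_def)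
    also have "\<dots> \<le> card (midpoints z x)"
      using that by (intro of_nat_mono card_mono finite_midpoints nbhd_out_nbhd_unreached_subset)
    finally show ?thesis
      using that by (auto simp: reach_def robust_second_out_nbhd_def out_nbhd_def)
  qed
  moreover have "y \<in> reach t' z"
    if y: "y \<in> robust_second_out_nbhd t v" "\<not> sparsely_joined (midpoints v y) z" for y
  proof -
    have "t' \<le> q * t" by (rule t')
    also have "\<dots> \<le> q * card (midpoints v y)"
      using y q_pos by (simp add: robust_second_out_nbhd_def)
    also have "\<dots> \<le> card (nbhd (midpoints v y) E z)"
      using y by (simp add: sparsely_joined_def)
    also have "\<dots> \<le> card (midpoints z y)"
      using z by (intro of_nat_mono card_mono finite_midpoints nbhd_midpoints_subset)
    finally show ?thesis
      using y by (auto simp: reach_def robust_second_out_nbhd_def)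
  qed
  ultimately show ?thesis
    by (auto simp: reach_def)
qed

lemma card_reach_diff_le:
  fixes t t' :: real
  assumes z: "z \<in> unreached v"
    and t': "t' \<le> q * t" "t' \<le> q * card (out_nbhd (unreached v) A z)"
    and large: "m \<le> card (out_nbhd (unreached v) A z)"
  shows "card (reach t v - reach t' z)
    \<le> m + card {y \<in> robust_second_out_nbhd t v. sparsely_joined (midpoints v y) z}"
proof -
  define X where "X = {x \<in> out_nbhd V A v. sparsely_joined (out_nbhd (unreached v) A z) x}"
  define Y where "Y = {y \<in> robust_second_out_nbhd t v. sparsely_joined (midpoints v y) z}"
  have "card (reach t v - reach t' z) \<le> card (X \<union> Y)"
    unfolding X_def Y_def using finite_V reach_diff_subset[OF z t']
    by (intro card_mono) (auto simp: robust_second_out_nbhd_def)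
  also have "\<dots> \<le> card X + card Y" by (rule card_Un_le)
  moreover have "card X < m"
    unfolding X_def using large unreached_subset[of v]
    by (intro card_sparsely_joined_less) (auto simp: out_nbhd_def unreached_def)
  ultimately show ?thesis
    unfolding Y_def[symmetric] by linarith
qed

lemma card_frequently_sparsely_joined_unreached_le:
  fixes a t :: real
  assumes "m \<le> t"
  shows "a * card {z \<in> unreached v.
      a \<le> card {y \<in> robust_second_out_nbhd t v. sparsely_joined (midpoints v y) z}}
    \<le> m * card V"
proof -
  let ?Y = "robust_second_out_nbhd t v"
  have Y: "?Y \<subseteq> V" by (auto simp: robust_second_out_nbhd_def)
  have "card {z \<in> unreached v. sparsely_joined (midpoints v y) z} < m" if "y \<in> ?Y" for y
  proof (rule card_sparsely_joined_less)
    show "midpoints v y \<subseteq> V" by (auto simp: midpoints_def out_nbhd_def)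
    show "m \<le> card (midpoints v y)"
      using that assms by (simp add: robust_second_out_nbhd_def)
  qed (rule unreached_subset midpoints_disjoint_unreached)+
  then have "a * card {z \<in> unreached v. a \<le> card {y \<in> ?Y. sparsely_joined (midpoints v y) z}}
      \<le> m * card ?Y"
    using finite_unreached finite_subset[OF Y finite_V]
    by (intro card_frequently_related_le less_imp_le)
  also have "\<dots> \<le> m * card V"
    using card_mono[OF finite_V Y] m_ge_1 by simp
  finally show ?thesis .
qed

lemma ex_well_joined_unreached:
  fixes b t :: real
  assumes b: "2 * b \<le> card (unreached v)" "4 * m \<le> b" and t: "m \<le> t"
  obtains z where "z \<in> unreached v"
    and "q * b / 8 \<le> card (out_nbhd (unreached v) A z)"
    and "card {y \<in> robust_second_out_nbhd t v. sparsely_joined (midpoints v y) z}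
      \<le> m * card V / b"
proof -
  let ?lost = "\<lambda>z. {y \<in> robust_second_out_nbhd t v. sparsely_joined (midpoints v y) z}"
  define a where "a = m * card V / b"
  define U where "U = unreached v - {z \<in> unreached v. a \<le> card (?lost z)}"
  have b_pos: "0 < b" using b m_ge_1 by linarith
  have "card (unreached v) \<le> card V"
    using unreached_subset finite_V by (rule card_mono[rotated])
  then have a_pos: "0 < a" using b b_pos m_ge_1 by (simp add: a_def)
  have "a * card {z \<in> unreached v. a \<le> card (?lost z)} \<le> m * card V"
    using t by (rule card_frequently_sparsely_joined_unreached_le)
  also have "\<dots> = a * b" using b_pos by (simp add: a_def)
  finally have "card {z \<in> unreached v. a \<le> card (?lost z)} \<le> b" using a_pos by simp
  moreover have "card (unreached v) - card {z \<in> unreached v. a \<le> card (?lost z)} \<le> card U"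
    unfolding U_def using finite_unreached by (intro diff_card_le_card_Diff) simp
  ultimately have card_U: "b \<le> card U" using b by linarith
  have "U \<subseteq> V" using unreached_subset by (auto simp: U_def)
  then obtain z where z: "z \<in> U" "q * card U / 8 \<le> card (out_nbhd U A z)"
    using ex_large_out_nbhd[of U] card_U b by auto
  show thesis
  proof
    show "z \<in> unreached v" using z by (simp add: U_def)
    have "q * b / 8 \<le> q * card U / 8" using card_U q_pos by simp
    also note z(2)
    also have "card (out_nbhd U A z) \<le> card (out_nbhd (unreached v) A z)"
      using finite_unreached by (intro card_mono out_nbhd_mono) (auto simp: U_def)
    finally show "q * b / 8 \<le> card (out_nbhd (unreached v) A z)" by simp
    show "card (?lost z) \<le> m * card V / b"
      using z(1) by (auto simp: U_def a_def)
  qed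
qed

lemma reach_grows:
  fixes b t t' :: real
  assumes v: "v \<in> V" "\<not> seymour_vertex V A v" "card (out_nbhd V A v) \<le> card V / 2 - b"
    and b: "8 * m \<le> q * b" "0 < b"
    and t: "m \<le> t" "t' \<le> q * t" "t' \<le> q * (q * b / 8)"
  obtains z where "z \<in> V"
    and "card (reach t v) + q * b / 8 \<le> card (reach t' z) + (m + m * card V / b)"
proof -
  have "2 * b \<le> card (unreached v)"
    using card_le_unreached[OF v(1,2)] v(3) by linarith
  moreover have "4 * m \<le> b"
    using b q_le_1 m_ge_1 mult_right_mono[of q 1 b] by linarith
  ultimately obtain z where z: "z \<in> unreached v"
    and gain: "q * b / 8 \<le> card (out_nbhd (unreached v) A z)"
    and loss: "card {y \<in> robust_second_out_nbhd t v. sparsely_joined (midpoints v y) z}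
      \<le> m * card V / b"
    using ex_well_joined_unreached t(1) by blast
  have "q * (q * b / 8) \<le> q * card (out_nbhd (unreached v) A z)"
    using gain q_pos by (intro mult_left_mono) auto
  then have "card (reach t v - reach t' z) \<le> m + m * card V / b"
    using card_reach_diff_le[OF z t(2)] t(3) gain loss b(1) by linarith
  moreover have "card (reach t v) + card (out_nbhd (unreached v) A z)
      \<le> card (reach t' z) + card (reach t v - reach t' z)"
    using t(1) m_ge_1 by (intro card_reach_add_card_out_nbhd_unreached_le) simp
  ultimately have "card (reach t v) + q * b / 8 \<le> card (reach t' z) + (m + m * card V / b)"
    using gain by linarith
  then show thesis
    using z unreached_subset by (intro that[of z]) auto
qed

text \<open>Each step gains \<open>q b / 8\<close> vertices and loses at most half as many.\<close>

lemma ex_large_reach: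
  fixes b :: real
  assumes no_seymour: "\<And>v. \<not> seymour_vertex V A v"
    and deg: "\<And>v. v \<in> V \<Longrightarrow> card (out_nbhd V A v) \<le> card V / 2 - b" and b: "0 < b"
    and loss: "m + m * card V / b \<le> q * b / 16"
    and threshold: "m \<le> q * b / 8 * q ^ k"
    and V: "V \<noteq> {}"
  shows "\<exists>v\<in>V. k * (q * b / 16) \<le> card (reach (q * b / 8 * q ^ k) v)"
  using threshold
proof (induction k)
  case 0
  then show ?case using V by auto
next
  case (Suc k)
  let ?t = "\<lambda>k. q * b / 8 * q ^ k"
  have t: "?t (Suc k) \<le> ?t k" "?t (Suc k) \<le> q * (q * b / 8)"
    using b q_pos q_le_1 by (auto simp: mult_le_one power_le_one mult_left_le)
  have m_le: "m \<le> ?t k" using Suc.prems t(1) by linarith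
  then obtain v where v: "v \<in> V" "k * (q * b / 16) \<le> card (reach (?t k) v)"
    using Suc.IH by blast
  have "0 \<le> m * card V / b" using m_ge_1 b by simp
  then have "8 * m \<le> q * b" using loss m_ge_1 by linarith
  then obtain z where "z \<in> V"
    "card (reach (?t k) v) + q * b / 8 \<le> card (reach (?t (Suc k)) z) + (m + m * card V / b)"
    using reach_grows[OF v(1) no_seymour deg[OF v(1)] _ b m_le _ t(2)] by (auto simp: mult_ac)
  moreover have "Suc k * (q * b / 16) = k * (q * b / 16) + q * b / 16"
    by (simp add: algebra_simps)
  ultimately have "z \<in> V" "Suc k * (q * b / 16) \<le> card (reach (?t (Suc k)) z)"
    using v(2) loss by linarith+
  then show ?case by blast
qed

lemma ex_seymour_vertex:
  fixes b :: real
  assumes V: "V \<noteq> {}"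
    and deg: "\<And>v. v \<in> V \<Longrightarrow> card (out_nbhd V A v) \<le> card V / 2 - b" and b: "0 < b"
    and loss: "m + m * card V / b \<le> q * b / 16"
    and threshold: "m \<le> q * b / 8 * q ^ k"
    and many_steps: "card V < k * (q * b / 16)"
  shows "\<exists>v. seymour_vertex V A v"
proof (rule ccontr)
  assume "\<nexists>v. seymour_vertex V A v"
  then obtain v where "k * (q * b / 16) \<le> card (reach (q * b / 8 * q ^ k) v)"
    using ex_large_reach[OF _ deg b loss threshold V] by blast
  also have "\<dots> \<le> card V"
    using reach_subset finite_V by (intro of_nat_mono card_mono)
  finally show False using many_steps by simp
qed

end

lemma ex_scale_and_step_count:
  fixes q \<gamma> :: real
  assumes q: "0 < q" and \<gamma>: "0 < \<gamma>"
  obtains \<epsilon> :: real and K :: nat where "0 < \<epsilon>" and "\<epsilon> * (1 + 1 / \<gamma>) \<le> q * \<gamma> / 16"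
    and "\<epsilon> \<le> q * \<gamma> / 8 * q ^ K" and "1 < K * (q * \<gamma> / 16)"
proof -
  have "0 < q * \<gamma> / 16" using q \<gamma> by simp
  then obtain K :: nat where K: "1 < K * (q * \<gamma> / 16)"
    using ex_less_of_nat_mult by blast
  define \<epsilon> where "\<epsilon> = min (q * \<gamma> / 16 / (1 + 1 / \<gamma>)) (q * \<gamma> / 8 * q ^ K)"
  have pos: "0 < 1 + 1 / \<gamma>" using \<gamma> by (simp add: add_pos_pos)
  have "0 < \<epsilon>" using q \<gamma> pos by (simp add: \<epsilon>_def)
  moreover have "\<epsilon> \<le> q * \<gamma> / 16 / (1 + 1 / \<gamma>)"
    unfolding \<epsilon>_def by (rule min.cobounded1)
  then have "\<epsilon> * (1 + 1 / \<gamma>) \<le> q * \<gamma> / 16"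
    unfolding pos_le_divide_eq[OF pos] .
  moreover have "\<epsilon> \<le> q * \<gamma> / 8 * q ^ K"
    unfolding \<epsilon>_def by (rule min.cobounded2)
  ultimately show thesis using K by (intro that)
qed

proposition ex_seymour_vertex_if_bidense:
  fixes q \<gamma> :: real
  assumes q: "0 < q" "q \<le> 1" and \<gamma>: "0 < \<gamma>"
  obtains \<epsilon> :: real where "0 < \<epsilon>"
    and "\<And>(V :: 'a set) E A. \<lbrakk>finite V; 1 \<le> \<epsilon> * card V; bidense V E q (\<epsilon> * card V);
        \<And>v. v \<in> V \<Longrightarrow> card (nbhd V E v) \<le> (1 / 2 - \<gamma>) * card V; orientation_of E A\<rbrakk>
      \<Longrightarrow> \<exists>v. seymour_vertex V A v"
proof -
  obtain \<epsilon> :: real and K :: nat where \<epsilon>: "0 < \<epsilon>"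
    and loss: "\<epsilon> * (1 + 1 / \<gamma>) \<le> q * \<gamma> / 16"
    and threshold: "\<epsilon> \<le> q * \<gamma> / 8 * q ^ K" and K: "1 < K * (q * \<gamma> / 16)"
    using q(1) \<gamma> by (rule ex_scale_and_step_count)
  show thesis
  proof (rule that[OF \<epsilon>])
    fix V :: "'a set" and E A
    assume finite: "finite V" and large: "1 \<le> \<epsilon> * card V" and dense: "bidense V E q (\<epsilon> * card V)"
      and deg: "\<And>v. v \<in> V \<Longrightarrow> card (nbhd V E v) \<le> (1 / 2 - \<gamma>) * card V"
      and orientation: "orientation_of E A"
    interpret bidense_orientation V E A q "\<epsilon> * card V"
      using finite large dense orientation q by unfold_locales
    have V: "V \<noteq> {}" "0 < real (card V)" using large finite by (auto simp: card_gt_0_iff)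
    show "\<exists>v. seymour_vertex V A v"
    proof (rule ex_seymour_vertex[where k = K])
      fix v assume "v \<in> V"
      have "card (out_nbhd V A v) \<le> card (nbhd V E v)"
        using finite by (intro card_mono out_nbhd_subset_nbhd orientation) auto
      then show "card (out_nbhd V A v) \<le> card V / 2 - \<gamma> * card V"
        using deg[OF \<open>v \<in> V\<close>] by (simp add: algebra_simps)
    next
      show "\<epsilon> * card V + \<epsilon> * card V * card V / (\<gamma> * card V) \<le> q * (\<gamma> * card V) / 16"
        using mult_right_mono[OF loss, of "card V"] V by (simp add: algebra_simps)
      show "\<epsilon> * card V \<le> q * (\<gamma> * card V) / 8 * q ^ K"
        using mult_right_mono[OF threshold, of "card V"] by (simp add: mult_ac)
      show "card V < K * (q * (\<gamma> * card V) / 16)"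
        using mult_strict_right_mono[OF K V(2)] by (simp add: mult_ac)
    qed (use V \<gamma> in auto)
  qed
qed

section \<open>Concentration in the binomial random graph\<close>

lemma finite_complete_edges: "finite V \<Longrightarrow> finite (complete_edges V)"
  by (rule finite_subset[of _ "Pow V"]) (auto simp: complete_edges_def)

lemma gnp_0: "gnp n 0 = return_pmf {}"
proof -
  have "bernoulli_pmf 0 = return_pmf False"
  proof (rule pmf_eqI)
    show "pmf (bernoulli_pmf 0) x = pmf (return_pmf False) x" for x
      by (cases x) auto
  qed
  then show ?thesis
    by (simp add: gnp_def finite_complete_edges)
qed

lemma map_card_Int_gnp:
  assumes "F \<subseteq> complete_edges {..<n}" "p \<in> {0..1}"
  shows "map_pmf (\<lambda>E. card (E \<inter> F)) (gnp n p) = binomial_pmf (card F) p"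
proof -
  let ?C = "complete_edges {..<n}"
  have fin: "finite ?C" "finite F"
    using finite_complete_edges assms by (auto intro: finite_subset)
  have "binomial_pmf (card F) p =
      map_pmf (\<lambda>f. card {x \<in> F. f x}) (Pi_pmf F False (\<lambda>_. bernoulli_pmf p))"
    using fin assms by (intro binomial_pmf_altdef') auto
  also have "Pi_pmf F False (\<lambda>_. bernoulli_pmf p) =
      map_pmf (\<lambda>f x. if x \<in> F then f x else False) (Pi_pmf ?C False (\<lambda>_. bernoulli_pmf p))"
    using fin assms by (intro Pi_pmf_subset) auto
  finally have "binomial_pmf (card F) p =
      map_pmf (\<lambda>f. card {x \<in> F. f x}) (Pi_pmf ?C False (\<lambda>_. bernoulli_pmf p))"
    by (simp add: pmf.map_comp o_def cong: conj_cong)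
  moreover have "{e \<in> ?C. f e} \<inter> F = {x \<in> F. f x}" for f
    using assms by auto
  ultimately show ?thesis
    by (simp add: gnp_def pmf.map_comp o_def)
qed

lemma prob_gnp_card_Int:
  assumes "F \<subseteq> complete_edges {..<n}" "p \<in> {0..1}"
  shows "measure_pmf.prob (gnp n p) {E. P (card (E \<inter> F))} =
    measure_pmf.prob (binomial_pmf (card F) p) {k. P k}"
  unfolding map_card_Int_gnp[OF assms, symmetric] by (simp add: vimage_def)

lemma prob_gnp_card_Int_le:
  fixes p \<delta> :: real
  assumes "F \<subseteq> complete_edges {..<n}" "p \<in> {0..1}" "0 \<le> \<delta>"
  shows "measure_pmf.prob (gnp n p) {E. card (E \<inter> F) \<le> (p - \<delta>) * card F}
    \<le> exp (- 2 * \<delta>\<^sup>2 * card F)"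
proof (cases "card F = 0")
  case False
  interpret binomial_distribution "card F" p
    using assms by unfold_locales
  have "measure_pmf.prob (gnp n p) {E. card (E \<inter> F) \<le> (p - \<delta>) * card F} =
      measure_pmf.prob (binomial_pmf (card F) p) {k. k \<le> card F * p - \<delta> * card F}"
    using assms by (subst prob_gnp_card_Int) (auto simp: algebra_simps)
  also have "\<dots> \<le> exp (- 2 * (\<delta> * card F)\<^sup>2 / card F)"
    using False assms by (intro prob_le) auto
  finally show ?thesis
    using False by (simp add: power2_eq_square mult_ac)
qed simp

lemma prob_gnp_card_Int_ge:
  fixes p \<delta> :: real
  assumes "F \<subseteq> complete_edges {..<n}" "p \<in> {0..1}" "0 \<le> \<delta>"
  shows "measure_pmf.prob (gnp n p) {E. (p + \<delta>) * card F \<le> card (E \<inter> F)}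
    \<le> exp (- 2 * \<delta>\<^sup>2 * card F)"
proof (cases "card F = 0")
  case False
  interpret binomial_distribution "card F" p
    using assms by unfold_locales
  have "measure_pmf.prob (gnp n p) {E. (p + \<delta>) * card F \<le> card (E \<inter> F)} =
      measure_pmf.prob (binomial_pmf (card F) p) {k. card F * p + \<delta> * card F \<le> k}"
    using assms by (subst prob_gnp_card_Int) (auto simp: algebra_simps)
  also have "\<dots> \<le> exp (- 2 * (\<delta> * card F)\<^sup>2 / card F)"
    using False assms by (intro prob_ge) auto
  finally show ?thesis
    using False by (simp add: power2_eq_square mult_ac)
qed simp

lemma prob_gnp_card_edges_between_less:
  fixes p \<delta> :: real
  assumes "S \<subseteq> {..<n}" "T \<subseteq> {..<n}" "S \<inter> T = {}" "p \<in> {0..1}" "0 \<le> \<delta>"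
  shows "measure_pmf.prob (gnp n p)
      {E. card (edges_between E S T) < (p - \<delta>) * (card S * card T)}
    \<le> exp (- 2 * \<delta>\<^sup>2 * (card S * card T))"
proof -
  define f :: "nat \<times> nat \<Rightarrow> nat set" where "f = (\<lambda>(s, t). {s, t})"
  define F where "F = f ` (S \<times> T)"
  have inj: "inj_on f (S \<times> T)"
    using assms(3) by (auto simp: inj_on_def f_def doubleton_eq_iff)
  have F: "F \<subseteq> complete_edges {..<n}"
    using assms by (auto simp: F_def f_def complete_edges_def card_insert_if)
  have card_F: "card F = card S * card T"
    by (simp add: F_def card_image[OF inj] card_cartesian_product)
  have card_edges: "card (edges_between E S T) = card (E \<inter> F)" for E
  proof -
    have "E \<inter> F = f ` edges_between E S T" by (auto simp: F_def f_def edges_between_def)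
    moreover have "inj_on f (edges_between E S T)"
      using inj by (rule inj_on_subset) (auto simp: edges_between_def)
    ultimately show ?thesis by (simp add: card_image)
  qed
  have "measure_pmf.prob (gnp n p)
      {E. card (edges_between E S T) < (p - \<delta>) * (card S * card T)}
    \<le> measure_pmf.prob (gnp n p) {E. card (E \<inter> F) \<le> (p - \<delta>) * card F}"
    by (intro measure_pmf.finite_measure_mono) (auto simp: card_edges card_F)
  also have "\<dots> \<le> exp (- 2 * \<delta>\<^sup>2 * card F)"
    using F assms by (intro prob_gnp_card_Int_le)
  finally show ?thesis by (simp only: card_F)
qed

lemma prob_gnp_not_bidense:
  fixes p \<delta> m :: real
  assumes "p \<in> {0..1}" "0 \<le> \<delta>" "0 \<le> m"
  shows "measure_pmf.prob (gnp n p) {E. \<not> bidense {..<n} E (p - \<delta>) m}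
    \<le> 4 ^ n * exp (- 2 * \<delta>\<^sup>2 * m\<^sup>2)"
proof -
  define I where "I = {(S, T). S \<subseteq> {..<n} \<and> T \<subseteq> {..<n} \<and> S \<inter> T = {} \<and> m \<le> card S \<and> m \<le> card T}"
  define sparse where "sparse = (\<lambda>(S :: nat set, T).
     {E. card (edges_between E S T) < (p - \<delta>) * (card S * card T)})"
  have I: "I \<subseteq> Pow {..<n} \<times> Pow {..<n}" by (auto simp: I_def)
  then have fin: "finite I" by (rule finite_subset) auto
  have "card I \<le> card (Pow {..<n} \<times> Pow {..<n})" using I by (intro card_mono) auto
  also have "\<dots> = 4 ^ n" by (simp add: card_cartesian_product card_Pow flip: power_mult_distrib)
  finally have card_I: "real (card I) \<le> 4 ^ n" by (simp flip: of_nat_le_iff)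
  have prob_sparse: "measure_pmf.prob (gnp n p) (sparse i) \<le> exp (- 2 * \<delta>\<^sup>2 * m\<^sup>2)"
    if "i \<in> I" for i
  proof -
    obtain S T where i: "i = (S, T)" and ST: "S \<subseteq> {..<n}" "T \<subseteq> {..<n}" "S \<inter> T = {}"
      and le: "m \<le> card S" "m \<le> card T"
      using \<open>i \<in> I\<close> by (auto simp: I_def)
    have "m\<^sup>2 \<le> card S * card T"
      using le assms by (auto simp: power2_eq_square intro!: mult_mono)
    then have "exp (- 2 * \<delta>\<^sup>2 * (card S * card T)) \<le> exp (- 2 * \<delta>\<^sup>2 * m\<^sup>2)"
      by (simp add: mult_left_mono)
    with prob_gnp_card_edges_between_less[OF ST assms(1,2)] show ?thesis
      unfolding sparse_def i by (simp only: prod.case)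
  qed
  have "{E. \<not> bidense {..<n} E (p - \<delta>) m} = (\<Union>i\<in>I. sparse i)"
    by (auto simp: bidense_def I_def sparse_def not_le)
  also have "measure_pmf.prob (gnp n p) \<dots> \<le> (\<Sum>i\<in>I. measure_pmf.prob (gnp n p) (sparse i))"
    using fin by (intro measure_pmf.finite_measure_subadditive_finite) auto
  also have "\<dots> \<le> card I * exp (- 2 * \<delta>\<^sup>2 * m\<^sup>2)"
    using prob_sparse by (rule sum_bounded_above)
  also have "\<dots> \<le> 4 ^ n * exp (- 2 * \<delta>\<^sup>2 * m\<^sup>2)"
    using card_I by (simp add: mult_right_mono)
  finally show ?thesis .
qed

lemma prob_gnp_card_nbhd_greater:
  fixes p \<delta> :: real
  assumes "v < n" "p \<in> {0..1}" "0 \<le> \<delta>"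
  shows "measure_pmf.prob (gnp n p) {E. (p + \<delta>) * n < card (nbhd {..<n} E v)}
    \<le> exp (- 2 * \<delta>\<^sup>2 * (real n - 1))"
proof -
  define f where "f w = {v, w}" for w
  define F where "F = f ` ({..<n} - {v})"
  have inj: "inj_on f B" for B
    by (auto simp: inj_on_def f_def doubleton_eq_iff)
  have F: "F \<subseteq> complete_edges {..<n}"
    using assms by (auto simp: F_def f_def complete_edges_def card_2_iff)
  have card_F: "real (card F) = real n - 1"
    using assms by (simp add: F_def card_image inj of_nat_diff)
  have card_nbhd: "card (nbhd {..<n} E v) = card (E \<inter> F)" for E
  proof -
    have "E \<inter> F = f ` nbhd {..<n} E v" by (auto simp: F_def f_def nbhd_def)
    then show ?thesis by (simp add: card_image inj)
  qed
  have "(p + \<delta>) * (real n - 1) \<le> (p + \<delta>) * n"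
    using assms by (intro mult_left_mono) auto
  then have "measure_pmf.prob (gnp n p) {E. (p + \<delta>) * n < card (nbhd {..<n} E v)}
    \<le> measure_pmf.prob (gnp n p) {E. (p + \<delta>) * card F \<le> card (E \<inter> F)}"
    by (intro measure_pmf.finite_measure_mono) (auto simp: card_nbhd card_F)
  also have "\<dots> \<le> exp (- 2 * \<delta>\<^sup>2 * card F)"
    using F assms by (intro prob_gnp_card_Int_ge)
  finally show ?thesis by (simp only: card_F)
qed

lemma prob_gnp_max_degree_greater:
  fixes p \<delta> :: real
  assumes "p \<in> {0..1}" "0 \<le> \<delta>"
  shows "measure_pmf.prob (gnp n p) {E. \<exists>v<n. (p + \<delta>) * n < card (nbhd {..<n} E v)}
    \<le> n * exp (- 2 * \<delta>\<^sup>2 * (real n - 1))"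
proof -
  define high where "high v = {E. (p + \<delta>) * n < card (nbhd {..<n} E v)}" for v
  have "{E. \<exists>v<n. (p + \<delta>) * n < card (nbhd {..<n} E v)} = (\<Union>v<n. high v)"
    by (auto simp: high_def)
  also have "measure_pmf.prob (gnp n p) \<dots> \<le> (\<Sum>v<n. measure_pmf.prob (gnp n p) (high v))"
    by (intro measure_pmf.finite_measure_subadditive_finite) auto
  also have "\<dots> \<le> card {..<n} * exp (- 2 * \<delta>\<^sup>2 * (real n - 1))"
    unfolding high_def using assms by (intro sum_bounded_above prob_gnp_card_nbhd_greater) auto
  finally show ?thesis by simp
qed

section \<open>Events that hold asymptotically almost surely\<close>

definition aas :: "(nat \<Rightarrow> 'a pmf) \<Rightarrow> (nat \<Rightarrow> 'a \<Rightarrow> bool) \<Rightarrow> bool" where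
  "aas M P \<longleftrightarrow> (\<lambda>n. measure_pmf.prob (M n) {x. P n x}) \<longlonglongrightarrow> 1"

lemma aas_iff_prob_not_tendsto_0:
  "aas M P \<longleftrightarrow> (\<lambda>n. measure_pmf.prob (M n) {x. \<not> P n x}) \<longlonglongrightarrow> 0"
proof -
  have prob_not:
    "measure_pmf.prob (M n) {x. \<not> P n x} = 1 - measure_pmf.prob (M n) {x. P n x}" for n
    using measure_pmf.prob_neg[of "M n" "P n"] by simp
  show ?thesis
  proof
    assume "aas M P"
    then have "(\<lambda>n. 1 - measure_pmf.prob (M n) {x. P n x}) \<longlonglongrightarrow> 1 - 1"
      unfolding aas_def by (intro tendsto_intros)
    then show "(\<lambda>n. measure_pmf.prob (M n) {x. \<not> P n x}) \<longlonglongrightarrow> 0"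
      by (simp add: prob_not)
  next
    assume "(\<lambda>n. measure_pmf.prob (M n) {x. \<not> P n x}) \<longlonglongrightarrow> 0"
    then have "(\<lambda>n. 1 - (1 - measure_pmf.prob (M n) {x. P n x})) \<longlonglongrightarrow> 1 - 0"
      unfolding prob_not by (intro tendsto_intros)
    then show "aas M P"
      by (simp add: aas_def)
  qed
qed

lemma aasI:
  assumes "b \<longlonglongrightarrow> 0" "\<And>n. measure_pmf.prob (M n) {x. \<not> P n x} \<le> b n"
  shows "aas M P"
  unfolding aas_iff_prob_not_tendsto_0
  using assms by (intro tendsto_sandwich[OF _ _ tendsto_const assms(1)]) auto

lemma aas_mono_conj:
  assumes "aas M P" "aas M Q" "\<forall>\<^sub>F n in sequentially. \<forall>x. P n x \<longrightarrow> Q n x \<longrightarrow> R n x"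
  shows "aas M R"
proof -
  have lim: "(\<lambda>n. measure_pmf.prob (M n) {x. \<not> P n x} + measure_pmf.prob (M n) {x. \<not> Q n x}) \<longlonglongrightarrow> 0"
    using assms(1,2) tendsto_add unfolding aas_iff_prob_not_tendsto_0 by fastforce
  have "\<forall>\<^sub>F n in sequentially. measure_pmf.prob (M n) {x. \<not> R n x}
      \<le> measure_pmf.prob (M n) {x. \<not> P n x} + measure_pmf.prob (M n) {x. \<not> Q n x}"
    using assms(3)
  proof eventually_elim
    case (elim n)
    then have "measure_pmf.prob (M n) {x. \<not> R n x}
        \<le> measure_pmf.prob (M n) ({x. \<not> P n x} \<union> {x. \<not> Q n x})"
      by (intro measure_pmf.finite_measure_mono) auto
    also have "\<dots> \<le> measure_pmf.prob (M n) {x. \<not> P n x} + measure_pmf.prob (M n) {x. \<not> Q n x}"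
      by (rule measure_Un_le) auto
    finally show ?case .
  qed
  then show ?thesis
    unfolding aas_iff_prob_not_tendsto_0
    by (intro tendsto_sandwich[OF _ _ tendsto_const lim]) auto
qed

lemma aas_gnp_bidense:
  fixes p \<delta> \<epsilon> :: real
  assumes "p \<in> {0..1}" "0 < \<delta>" "0 < \<epsilon>"
  shows "aas (\<lambda>n. gnp n p) (\<lambda>n E. bidense {..<n} E (p - \<delta>) (\<epsilon> * n))"
proof (rule aasI)
  show "(\<lambda>n. 4 ^ n * exp (- 2 * \<delta>\<^sup>2 * (\<epsilon> * real n)\<^sup>2)) \<longlonglongrightarrow> 0"
    using assms by real_asymp
  show "measure_pmf.prob (gnp n p) {E. \<not> bidense {..<n} E (p - \<delta>) (\<epsilon> * n)}
      \<le> 4 ^ n * exp (- 2 * \<delta>\<^sup>2 * (\<epsilon> * n)\<^sup>2)" for n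
    using assms by (intro prob_gnp_not_bidense) auto
qed

lemma aas_gnp_max_degree_le:
  fixes p \<delta> :: real
  assumes "p \<in> {0..1}" "0 < \<delta>"
  shows "aas (\<lambda>n. gnp n p) (\<lambda>n E. \<forall>v<n. card (nbhd {..<n} E v) \<le> (p + \<delta>) * n)"
proof (rule aasI)
  show "(\<lambda>n. n * exp (- 2 * \<delta>\<^sup>2 * (real n - 1))) \<longlonglongrightarrow> 0"
    using assms by real_asymp
  show "measure_pmf.prob (gnp n p) {E. \<not> (\<forall>v<n. card (nbhd {..<n} E v) \<le> (p + \<delta>) * n)}
      \<le> n * exp (- 2 * \<delta>\<^sup>2 * (real n - 1))" for n
    using prob_gnp_max_degree_greater[of p \<delta> n] assms by (simp add: not_le)
qed

lemma aas_gnp_seymour_vertex: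
  assumes "0 < p" "p < 1 / 2"
  shows "aas (\<lambda>n. gnp n p) (\<lambda>n E. \<forall>A. orientation_of E A \<longrightarrow> (\<exists>v. seymour_vertex {..<n} A v))"
proof -
  define \<gamma> where "\<gamma> = (1 / 2 - p) / 2"
  have p: "p \<in> {0..1}" "0 < p / 2" and \<gamma>: "0 < \<gamma>" "p + \<gamma> = 1 / 2 - \<gamma>"
    using assms by (auto simp: \<gamma>_def field_simps)
  obtain \<epsilon> :: real where \<epsilon>: "0 < \<epsilon>" and seymour: "\<And>(V :: nat set) E A.
      \<lbrakk>finite V; 1 \<le> \<epsilon> * card V; bidense V E (p - p / 2) (\<epsilon> * card V);
       \<And>v. v \<in> V \<Longrightarrow> card (nbhd V E v) \<le> (1 / 2 - \<gamma>) * card V; orientation_of E A\<rbrakk>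
      \<Longrightarrow> \<exists>v. seymour_vertex V A v"
    using ex_seymour_vertex_if_bidense[of "p - p / 2" \<gamma>, where 'a = nat] p \<gamma> by auto
  have dense: "aas (\<lambda>n. gnp n p) (\<lambda>n E. bidense {..<n} E (p - p / 2) (\<epsilon> * n))"
    using p \<epsilon> by (rule aas_gnp_bidense)
  have degree: "aas (\<lambda>n. gnp n p) (\<lambda>n E. \<forall>v<n. card (nbhd {..<n} E v) \<le> (1 / 2 - \<gamma>) * n)"
    using aas_gnp_max_degree_le[OF p(1) \<gamma>(1)] unfolding \<gamma>(2) .
  have "\<forall>\<^sub>F n in sequentially. 1 \<le> \<epsilon> * real n"
    using \<epsilon> by real_asymp
  then show ?thesis
    using seymour[of "{..<_}"]
    by (intro aas_mono_conj[OF dense degree]) (auto elim!: eventually_mono)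
qed

theorem theorem1p2:
  fixes p :: real
  assumes "0 \<le> p" and "p < 1 / 2"
  shows "(\<lambda>n. measure_pmf.prob (gnp n p)
           {E. \<forall>A. orientation_of E A \<longrightarrow> (\<exists>v. seymour_vertex {..<n} A v)})
         \<longlonglongrightarrow> 1"
proof (cases "p = 0")
  case True
  have "measure_pmf.prob (gnp n p)
      {E. \<forall>A. orientation_of E A \<longrightarrow> (\<exists>v. seymour_vertex {..<n} A v)} = 1" if "0 < n" for n
    using that seymour_vertex_if_no_edges[of _ 0 "{..<n}"]
    by (auto simp: True gnp_0 indicator_def)
  then show ?thesis
    by (intro tendsto_eventually eventually_mono[OF eventually_gt_at_top[of 0]])
next
  case False
  then show ?thesis
    using aas_gnp_seymour_vertex[of p] assms by (simp add: aas_def)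
qed

end
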